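(* Any $G_{\delta\sigma}$ ideal $\mathcal J$ on $\omega$ is extendable to an $F_\sigma$ ideal, i.e. there is an $F_\sigma$ ideal $\mathcal J'$ on $\omega$ with $\mathcal J\subseteq\mathcal J'$.
   Context: An ideal on $\omega$ is a family of subsets of $\omega$ closed under finite unions and subsets, containing all finite sets and not containing $\omega$. $F_\sigma$ and $G_{\delta\sigma}$ (countable unions of $G_\delta$ sets) refer to subsets of $\mathcal P(\omega)$ with the Cantor space topology, identifying sets with characteristic functions in $\{0,1\}^\omega$. *)

theory Defs
  imports "HOL-Analysis.Analysis"
begin

text \<open>As \<open>J\<close> contains the empty set, closure under binary unions is closure under finite unions.\<close>

definition ideal_on_omega :: "nat set set \<Rightarrow> bool" where
  "ideal_on_omega J \<longleftrightarrow>
     (\<forall>A. finite A \<longrightarrow> A \<in> J) \<and>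
     (\<forall>A\<in>J. \<forall>B. B \<subseteq> A \<longrightarrow> B \<in> J) \<and>
     (\<forall>A\<in>J. \<forall>B\<in>J. A \<union> B \<in> J) \<and>
     UNIV \<notin> J"

definition cantor_space :: "(nat \<Rightarrow> bool) topology" where
  "cantor_space = product_topology (\<lambda>_. discrete_topology UNIV) UNIV"

definition powerset_topology :: "nat set topology" where
  "powerset_topology = pullback_topology UNIV (\<lambda>A n. n \<in> A) cantor_space"

lemma topspace_cantor_space [simp]: "topspace cantor_space = UNIV"
  by (simp add: cantor_space_def)

lemma homeomorphic_map_powerset_topology:
  "homeomorphic_map powerset_topology cantor_space (\<lambda>A n. n \<in> A)"
proof -
  have "homeomorphic_maps powerset_topology cantor_space (\<lambda>A n. n \<in> A) Collect"
    unfolding homeomorphic_maps_def powerset_topology_def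
    by (auto simp: topspace_pullback_topology comp_def
        intro: continuous_map_pullback[OF continuous_map_id, unfolded comp_def id_def]
               continuous_map_pullback')
  then show ?thesis
    using homeomorphic_map_maps by blast
qed

definition gdelta_sigma_in :: "'a topology \<Rightarrow> 'a set \<Rightarrow> bool" where
  "gdelta_sigma_in X = countable union_of gdelta_in X"

end

theory Submission
  imports Defs
begin

text \<open>
  Extend \<open>J\<close> to a prime ideal \<open>M\<close>, so that the complement of \<open>M\<close> is an ultrafilter disjoint from
  \<open>J\<close>; call its members large. It suffices to cover \<open>J\<close> by countably many closed hereditary
  families that contain no large set
  (\<open>gdelta_sigma_ideal_separation\<close>). Indeed, the ideal generated by such families is F-sigma, because
  unions of \<open>n\<close> members of a closed hereditary family again form a compact family, and it is
  proper, because it lies inside \<open>M\<close> (\<open>fsigma_ideal_from_closed_hereditary\<close>).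

  The separation rests on one use of Baire category. Write \<open>J\<close> as the union of G-delta sets
  \<open>G n\<close>. If \<open>A \<notin> J\<close>, then \<open>G n\<close> is nowhere dense in the power set of \<open>A\<close>: a G-delta set that
  is dense in a basic open set there is comeager in it, hence so is its image under
  complementation in \<open>A\<close>; the two meet, and \<open>A\<close> is the union of two members of \<open>G n\<close> up to a
  finite set, which puts \<open>A\<close> into \<open>J\<close>
  (\<open>gdelta_in_ideal_avoid\<close>).

  Now imagine a game in which one player presents large sets and the other answers, in round
  \<open>n\<close>, with a finite piece of the intersection \<open>A\<close> of the sets presented so far. As \<open>A\<close> is large and
  thus not in \<open>J\<close>, the answer can be chosen so that the final union of all answers avoids
  \<open>G n\<close>, as long as all later answers stay inside \<open>A\<close>. So the second player has a strategy that
  produces a set outside \<open>J\<close>. There are only countably many finite answers, so countably many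
  positions suffice. To a position assign the family of all \<open>B\<close> that contain no answer
  available there. The family is closed and hereditary; it contains no large set, since a large set
  is a legal move and hence includes an answer; and every \<open>B \<in> J\<close> belongs to one of these
  families, for otherwise some run of the game would have all its answers inside \<open>B\<close>, and the union
  of these answers would be a subset of \<open>B\<close> outside \<open>J\<close>.
\<close>

section \<open>Prime ideals\<close>

lemma ideal_on_omega_finite: "ideal_on_omega J \<Longrightarrow> finite A \<Longrightarrow> A \<in> J"
  by (simp add: ideal_on_omega_def)

lemma ideal_on_omega_subset: "ideal_on_omega J \<Longrightarrow> A \<in> J \<Longrightarrow> B \<subseteq> A \<Longrightarrow> B \<in> J"
  unfolding ideal_on_omega_def by (elim conjE) (drule bspec, assumption, simp)

lemma ideal_on_omega_Un: "ideal_on_omega J \<Longrightarrow> A \<in> J \<Longrightarrow> B \<in> J \<Longrightarrow> A \<union> B \<in> J"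
  by (simp add: ideal_on_omega_def)

lemma ideal_on_omega_proper: "ideal_on_omega J \<Longrightarrow> UNIV \<notin> J"
  by (simp add: ideal_on_omega_def)

lemma ideal_on_omega_UN:
  assumes "ideal_on_omega J" "finite I" "\<And>i. i \<in> I \<Longrightarrow> A i \<in> J"
  shows "(\<Union>i\<in>I. A i) \<in> J"
  using assms(2,3)
  by (induction I rule: finite_induct)
    (auto intro: ideal_on_omega_finite[OF assms(1)] ideal_on_omega_Un[OF assms(1)])

definition prime_ideal_on_omega :: "nat set set \<Rightarrow> bool" where
  "prime_ideal_on_omega M \<longleftrightarrow> ideal_on_omega M \<and> (\<forall>A. A \<in> M \<or> - A \<in> M)"

lemma prime_ideal_on_omega_Int:
  assumes "prime_ideal_on_omega M" "A \<notin> M" "B \<notin> M"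
  shows "A \<inter> B \<notin> M"
proof
  have M: "ideal_on_omega M" and "- A \<in> M" "- B \<in> M"
    using assms by (auto simp: prime_ideal_on_omega_def)
  moreover assume "A \<inter> B \<in> M"
  ultimately have "- A \<union> - B \<union> (A \<inter> B) \<in> M"
    by (intro ideal_on_omega_Un[OF M])
  moreover have "- A \<union> - B \<union> (A \<inter> B) = UNIV" by blast
  ultimately show False using ideal_on_omega_proper[OF M] by simp
qed

lemma prime_ideal_on_omega_INT:
  assumes "prime_ideal_on_omega M" "finite I" "\<And>i. i \<in> I \<Longrightarrow> A i \<notin> M"
  shows "(\<Inter>i\<in>I. A i) \<notin> M"
  using assms(2,3)
proof (induction I rule: finite_induct)
  case empty
  then show ?case
    using assms(1) by (simp add: prime_ideal_on_omega_def ideal_on_omega_proper)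
next
  case (insert i I)
  then show ?case
    using prime_ideal_on_omega_Int[OF assms(1), of "A i" "\<Inter>i\<in>I. A i"] by simp
qed

text \<open>An ideal that is maximal among the proper ones is prime: if \<open>A \<notin> M\<close>, then adjoining \<open>A\<close> to \<open>M\<close>
  cannot give a proper ideal, so \<open>A\<close> and some member of \<open>M\<close> together cover everything.\<close>

lemma ideal_on_omega_extend_prime:
  assumes J: "ideal_on_omega J"
  obtains M where "prime_ideal_on_omega M" "J \<subseteq> M"
proof -
  let ?\<A> = "{I. ideal_on_omega I \<and> J \<subseteq> I}"
  have "\<exists>M\<in>?\<A>. \<forall>X\<in>?\<A>. M \<subseteq> X \<longrightarrow> X = M"
  proof (rule subset_Zorn_nonempty)
    show "?\<A> \<noteq> {}" using J by blast
  next
    fix \<C> assume ne: "\<C> \<noteq> {}" and ch: "subset.chain ?\<A> \<C>"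
    have id: "ideal_on_omega I" "J \<subseteq> I" if "I \<in> \<C>" for I
      using ch that by (auto simp: subset.chain_def)
    have "A \<union> B \<in> \<Union>\<C>" if mem: "A \<in> I" "I \<in> \<C>" "B \<in> I'" "I' \<in> \<C>" for A B I I'
    proof -
      have "I \<subseteq> I' \<or> I' \<subseteq> I" using ch mem unfolding subset_chain_def by blast
      then obtain K where "K \<in> \<C>" "A \<in> K" "B \<in> K" using mem by blast
      then show ?thesis using ideal_on_omega_Un id(1) by blast
    qed
    moreover obtain I where "I \<in> \<C>" using ne by blast
    then have "A \<in> \<Union>\<C>" if "finite A" for A
      using ideal_on_omega_finite[OF id(1) that] by blast
    moreover have "B \<in> \<Union>\<C>" if "A \<in> \<Union>\<C>" "B \<subseteq> A" for A B
      using that ideal_on_omega_subset[OF id(1)] by blast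
    moreover have "UNIV \<notin> \<Union>\<C>"
      using ideal_on_omega_proper[OF id(1)] by blast
    ultimately have "ideal_on_omega (\<Union>\<C>)"
      unfolding ideal_on_omega_def by blast
    then show "\<Union>\<C> \<in> ?\<A>" using ne id by blast
  qed
  then obtain M where M: "ideal_on_omega M" "J \<subseteq> M"
    and max: "\<And>X. ideal_on_omega X \<Longrightarrow> M \<subseteq> X \<Longrightarrow> X = M"
    by (smt (verit) mem_Collect_eq subset_trans)
  have "- A \<in> M" if "A \<notin> M" for A
  proof -
    let ?X = "{B. \<exists>C\<in>M. B \<subseteq> C \<union> A}"
    have "M \<subseteq> ?X" "A \<in> ?X"
      using ideal_on_omega_finite[OF M(1), of "{}"] by auto
    then have "\<not> ideal_on_omega ?X" using max[of ?X] \<open>A \<notin> M\<close> by auto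
    moreover have "B \<union> B' \<in> ?X" if mem: "B \<in> ?X" "B' \<in> ?X" for B B'
    proof -
      obtain C C' where "C \<in> M" "B \<subseteq> C \<union> A" "C' \<in> M" "B' \<subseteq> C' \<union> A" using mem by auto
      then have "C \<union> C' \<in> M" "B \<union> B' \<subseteq> (C \<union> C') \<union> A"
        using ideal_on_omega_Un[OF M(1)] by auto
      then show ?thesis by blast
    qed
    moreover have "B \<in> ?X" if "finite B" for B
      using ideal_on_omega_finite[OF M(1) that] by blast
    moreover have "B' \<in> ?X" if "B \<in> ?X" "B' \<subseteq> B" for B B'
      using that by (auto dest: subset_trans)
    ultimately have "ideal_on_omega ?X" if "UNIV \<notin> ?X"
      unfolding ideal_on_omega_def using that by (intro conjI allI impI ballI)
    then have "UNIV \<in> ?X" using \<open>\<not> ideal_on_omega ?X\<close> by argo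
    then show ?thesis
      using ideal_on_omega_subset[OF M(1), of _ "- A"] by auto
  qed
  then show thesis
    using that M by (auto simp: prime_ideal_on_omega_def)
qed

section \<open>The topology on the power set\<close>

text \<open>The sets that agree with \<open>x\<close> below \<open>k\<close> form a neighbourhood base at \<open>x\<close>, since an open set of
  the product constrains only finitely many coordinates.\<close>

lemma openin_powerset_topology_iff:
  "openin powerset_topology S \<longleftrightarrow>
     (\<forall>x\<in>S. \<exists>k. \<forall>y. y \<inter> {..<k} = x \<inter> {..<k} \<longrightarrow> y \<in> S)" (is "?L \<longleftrightarrow> ?R")
proof
  assume ?L
  then obtain V where V: "openin cantor_space V" "S = (\<lambda>A n. n \<in> A) -` V"
    unfolding powerset_topology_def openin_pullback_topology by auto
  show ?R
  proof
    fix x assume "x \<in> S"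
    then have "(\<lambda>n. n \<in> x) \<in> V" using V by auto
    then obtain U where fin: "finite {i. U i \<noteq> (UNIV :: bool set)}"
      and x: "(\<lambda>n. n \<in> x) \<in> Pi\<^sub>E UNIV U" and U: "Pi\<^sub>E UNIV U \<subseteq> V"
      using V(1) unfolding cantor_space_def openin_product_topology_alt by fastforce
    obtain k where k: "\<And>i. U i \<noteq> UNIV \<Longrightarrow> i < k"
      using fin unfolding finite_nat_set_iff_bounded by auto
    have "y \<in> S" if "y \<inter> {..<k} = x \<inter> {..<k}" for y
    proof -
      have "(i \<in> y) \<in> U i" for i
      proof (cases "i < k")
        case True
        then have "(i \<in> y) = (i \<in> x)" using that by blast
        then show ?thesis using x by auto
      next
        case False
        then show ?thesis using k by blast
      qed
      then have "(\<lambda>i. i \<in> y) \<in> V" using U by auto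
      then show ?thesis using V(2) by simp
    qed
    then show "\<exists>k. \<forall>y. y \<inter> {..<k} = x \<inter> {..<k} \<longrightarrow> y \<in> S" by blast
  qed
next
  assume ?R
  have "openin cantor_space {f. Collect f \<in> S}"
    unfolding cantor_space_def openin_product_topology_alt
  proof (intro ballI)
    fix f assume "f \<in> {f. Collect f \<in> S}"
    then obtain k where k: "\<And>y. y \<inter> {..<k} = Collect f \<inter> {..<k} \<Longrightarrow> y \<in> S"
      using \<open>?R\<close> by blast
    let ?U = "\<lambda>i. if i < k then {f i} else UNIV"
    have "finite {i. ?U i \<noteq> UNIV}"
      by (rule finite_subset[of _ "{..<k}"]) auto
    moreover have "Pi\<^sub>E UNIV ?U \<subseteq> {f. Collect f \<in> S}"
    proof
      fix g assume "g \<in> Pi\<^sub>E UNIV ?U"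
      then have "g i = f i" if "i < k" for i
        using that by (auto simp: PiE_iff dest: spec[of _ i])
      then have "Collect g \<inter> {..<k} = Collect f \<inter> {..<k}" by auto
      then show "g \<in> {f. Collect f \<in> S}" using k by simp
    qed
    ultimately show "\<exists>U. finite {i \<in> UNIV. U i \<noteq> topspace (discrete_topology (UNIV :: bool set))} \<and>
        (\<forall>i\<in>UNIV. openin (discrete_topology UNIV) (U i)) \<and> f \<in> Pi\<^sub>E UNIV U \<and>
        Pi\<^sub>E UNIV U \<subseteq> {f. Collect f \<in> S}"
      by (intro exI[of _ ?U]) auto
  qed
  then show ?L
    unfolding powerset_topology_def openin_pullback_topology
    by (intro exI[of _ "{f. Collect f \<in> S}"]) auto
qed

lemma topspace_powerset_topology [simp]: "topspace powerset_topology = UNIV"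
  by (simp add: powerset_topology_def topspace_pullback_topology)

lemma closedin_powerset_topology_iff:
  "closedin powerset_topology S \<longleftrightarrow>
     (\<forall>x. (\<forall>k. \<exists>y\<in>S. y \<inter> {..<k} = x \<inter> {..<k}) \<longrightarrow> x \<in> S)"
proof -
  have "closedin powerset_topology S \<longleftrightarrow>
      (\<forall>x. x \<notin> S \<longrightarrow> (\<exists>k. \<forall>y. y \<inter> {..<k} = x \<inter> {..<k} \<longrightarrow> y \<notin> S))"
    by (simp add: closedin_def openin_powerset_topology_iff Ball_def)
  then show ?thesis by meson
qed

lemma completely_metrizable_powerset_topology:
  "completely_metrizable_space powerset_topology"
proof -
  have "completely_metrizable_space cantor_space"
    unfolding cantor_space_def
    by (simp add: completely_metrizable_space_product_topology
        completely_metrizable_space_discrete_topology)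
  then show ?thesis
    using homeomorphic_completely_metrizable_space homeomorphic_map_powerset_topology
      homeomorphic_map_imp_homeomorphic_space by blast
qed

section \<open>Baire category below a positive set\<close>

text \<open>The set \<open>N\<close> is a basic clopen piece of the power set of \<open>t \<union> A\<close>. Complementation inside \<open>A\<close> above
  \<open>m\<close> is a homeomorphic involution of \<open>N\<close>, so it maps the comeager set \<open>G \<inter> N\<close> to another
  comeager set. By the Baire category theorem the two have a common point \<open>y\<close>; then \<open>y\<close> and its
  reflection both lie in \<open>G\<close>.\<close>

lemma gdelta_dense_pair_covers:
  fixes A t :: "nat set" and m :: nat
  assumes G: "gdelta_in powerset_topology G" and t: "t \<subseteq> {..<m}"
  defines "N \<equiv> {y. y \<inter> {..<m} = t \<and> y \<subseteq> t \<union> A}"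
  assumes dense: "\<And>x k. x \<in> N \<Longrightarrow> \<exists>y\<in>G \<inter> N. y \<inter> {..<k} = x \<inter> {..<k}"
  shows "\<exists>y\<in>G. \<exists>z\<in>G. A \<subseteq> {..<m} \<union> y \<union> z"
proof -
  define X where "X = subtopology powerset_topology N"
  \<comment> \<open>the reflection of \<open>N\<close>\<close>
  define \<sigma> where "\<sigma> y = t \<union> (A - {..<m} - y)" for y
  have \<sigma>N: "\<sigma> y \<in> N" for y
    using t by (auto simp: \<sigma>_def N_def)
  have \<sigma>\<sigma>: "\<sigma> (\<sigma> y) = y" if "y \<in> N" for y
    using that t by (auto simp: \<sigma>_def N_def)
  have \<sigma>_agree: "\<sigma> y \<inter> {..<k} = \<sigma> x \<inter> {..<k}" if "y \<inter> {..<k} = x \<inter> {..<k}" for x y k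
    using that by (auto simp: \<sigma>_def)
  obtain V :: "nat \<Rightarrow> nat set set" where V: "\<And>n. openin powerset_topology (V n)" "(\<Inter>n. V n) = G"
    using G unfolding gdelta_in_descending by blast
  have "closedin powerset_topology N"
    unfolding closedin_powerset_topology_iff
  proof (intro allI impI)
    fix x assume *: "\<forall>k. \<exists>y\<in>N. y \<inter> {..<k} = x \<inter> {..<k}"
    then have "x \<inter> {..<m} = t" by (auto simp: N_def)
    moreover have "j \<in> t \<union> A" if "j \<in> x" for j
    proof -
      obtain y where "y \<in> N" "y \<inter> {..<Suc j} = x \<inter> {..<Suc j}" using * by blast
      then show ?thesis using that by (auto simp: N_def)
    qed
    ultimately show "x \<in> N" by (auto simp: N_def)
  qed
  then have "completely_metrizable_space X"
    unfolding X_def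
    by (rule completely_metrizable_space_closedin[OF completely_metrizable_powerset_topology])
  have topX: "topspace X = N" by (simp add: X_def)
  have denseI: "X closure_of T = topspace X"
    if T: "\<And>x k. x \<in> N \<Longrightarrow> \<exists>y\<in>T \<inter> N. y \<inter> {..<k} = x \<inter> {..<k}" for T
  proof -
    have "\<exists>y\<in>T. y \<in> U" if U: "x \<in> N" "openin X U" "x \<in> U" for x U
    proof -
      obtain W where W: "openin powerset_topology W" "U = W \<inter> N"
        using U(2) unfolding X_def openin_subtopology by blast
      then obtain k where "\<forall>y. y \<inter> {..<k} = x \<inter> {..<k} \<longrightarrow> y \<in> W"
        using \<open>x \<in> U\<close> unfolding openin_powerset_topology_iff by blast
      moreover obtain y where "y \<in> T" "y \<in> N" "y \<inter> {..<k} = x \<inter> {..<k}"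
        using T[OF \<open>x \<in> N\<close>, of k] by blast
      ultimately show ?thesis using W(2) by blast
    qed
    then show ?thesis unfolding closure_of_def topX by blast
  qed
  have "X closure_of \<Inter>(range (\<lambda>n. V n \<inter> N) \<union> range (\<lambda>n. {y. \<sigma> y \<in> V n} \<inter> N)) = topspace X"
  proof (rule Baire_category)
    show "completely_metrizable_space X \<or> locally_compact_space X \<and> regular_space X"
      using \<open>completely_metrizable_space X\<close> by blast
  next
    fix T assume "T \<in> range (\<lambda>n. V n \<inter> N) \<union> range (\<lambda>n. {y. \<sigma> y \<in> V n} \<inter> N)"
    then obtain n where "T = V n \<inter> N \<or> T = {y. \<sigma> y \<in> V n} \<inter> N" by blast
    then show "openin X T \<and> X closure_of T = topspace X"
    proof
      assume T: "T = V n \<inter> N"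
      have "G \<subseteq> V n" using V(2) by blast
      then have "X closure_of T = topspace X"
        using dense T by (intro denseI) (metis IntD1 IntD2 IntI subsetD)
      moreover have "openin X T"
        using V(1) unfolding T X_def openin_subtopology by blast
      ultimately show ?thesis by blast
    next
      assume T: "T = {y. \<sigma> y \<in> V n} \<inter> N"
      have "X closure_of T = topspace X"
      proof (rule denseI)
        fix x k assume "x \<in> N"
        obtain y where y: "y \<in> G" "y \<in> N" "y \<inter> {..<k} = \<sigma> x \<inter> {..<k}"
          using dense[OF \<sigma>N, of k x] by blast
        then have "\<sigma> y \<inter> {..<k} = x \<inter> {..<k}"
          using \<sigma>_agree \<sigma>\<sigma> \<open>x \<in> N\<close> by metis
        moreover have "\<sigma> y \<in> T"
          using y \<sigma>N \<sigma>\<sigma> V(2) by (auto simp: T)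
        ultimately show "\<exists>y\<in>T \<inter> N. y \<inter> {..<k} = x \<inter> {..<k}" using \<sigma>N by blast
      qed
      moreover have "openin powerset_topology {y. \<sigma> y \<in> V n}"
        using V(1)[of n] \<sigma>_agree unfolding openin_powerset_topology_iff by (metis mem_Collect_eq)
      then have "openin X T"
        unfolding T X_def openin_subtopology by blast
      ultimately show ?thesis by blast
    qed
  qed auto
  moreover have "topspace X \<noteq> {}" using \<sigma>N topX by blast
  ultimately have "\<Inter>(range (\<lambda>n. V n \<inter> N) \<union> range (\<lambda>n. {y. \<sigma> y \<in> V n} \<inter> N)) \<noteq> {}"
    by (metis closure_of_empty)
  then obtain y where y: "y \<in> \<Inter>(range (\<lambda>n. V n \<inter> N) \<union> range (\<lambda>n. {y. \<sigma> y \<in> V n} \<inter> N))"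
    by (meson ex_in_conv)
  have "y \<in> V n \<inter> N" "y \<in> {y. \<sigma> y \<in> V n} \<inter> N" for n
    by (rule InterD[OF y], blast)+
  then have "y \<in> G" "\<sigma> y \<in> G" using V(2) by auto
  moreover have "A \<subseteq> {..<m} \<union> y \<union> \<sigma> y" by (auto simp: \<sigma>_def)
  ultimately show ?thesis by blast
qed

text \<open>The finite set \<open>t'\<close> is an answer in the game: once an initial segment below \<open>m'\<close> is fixed to be
  \<open>t'\<close>, no continuation inside \<open>A\<close> can reach \<open>G\<close>. Such a \<open>t'\<close> exists because \<open>G\<close> is not dense in
  the piece given by \<open>t\<close> and \<open>m\<close>; density would make \<open>A\<close> the union of two members of \<open>J\<close> and a finite
  set.\<close>

lemma gdelta_in_ideal_avoid:
  assumes J: "ideal_on_omega J" and G: "gdelta_in powerset_topology G" "G \<subseteq> J"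
    and A: "A \<notin> J" and t: "t \<subseteq> {..<m}"
  obtains t' m' where "m \<le> m'" "t' \<subseteq> {..<m'}" "t' \<inter> {..<m} = t" "t' \<subseteq> t \<union> A"
    "\<And>y. y \<in> G \<Longrightarrow> y \<inter> {..<m'} = t' \<Longrightarrow> \<not> y \<subseteq> t' \<union> A"
proof -
  let ?N = "{y. y \<inter> {..<m} = t \<and> y \<subseteq> t \<union> A}"
  have "\<not> (\<exists>y\<in>G. \<exists>z\<in>G. A \<subseteq> {..<m} \<union> y \<union> z)"
    using A G(2) ideal_on_omega_subset[OF J] ideal_on_omega_Un[OF J]
      ideal_on_omega_finite[OF J, of "{..<m}"] by (meson finite_lessThan subsetD)
  then have "\<exists>x\<in>?N. \<exists>k. \<not> (\<exists>y\<in>G \<inter> ?N. y \<inter> {..<k} = x \<inter> {..<k})"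
    using gdelta_dense_pair_covers[OF G(1) t, of A] by blast
  then obtain x k where "x \<in> ?N" and nex: "\<not> (\<exists>y\<in>G \<inter> ?N. y \<inter> {..<k} = x \<inter> {..<k})"
    by (elim bexE exE)
  then have x: "x \<inter> {..<m} = t" "x \<subseteq> t \<union> A" by simp_all
  have k: "y \<inter> {..<k} \<noteq> x \<inter> {..<k}" if "y \<in> G" "y \<in> ?N" for y
    using nex that by (meson IntI)
  show thesis
  proof
    show "m \<le> max m k" "x \<inter> {..<max m k} \<subseteq> {..<max m k}" by auto
    show "x \<inter> {..<max m k} \<inter> {..<m} = t" "x \<inter> {..<max m k} \<subseteq> t \<union> A"
      using x by auto
    fix y assume y: "y \<in> G" "y \<inter> {..<max m k} = x \<inter> {..<max m k}"
    have agree: "y \<inter> {..<j} = x \<inter> {..<j}" if "j \<le> max m k" for j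
    proof -
      have "{..<j} = {..<max m k} \<inter> {..<j}" using that by auto
      then show ?thesis using y(2) by (metis Int_assoc)
    qed
    show "\<not> y \<subseteq> x \<inter> {..<max m k} \<union> A"
    proof
      assume "y \<subseteq> x \<inter> {..<max m k} \<union> A"
      then have "y \<in> ?N" using x agree[of m] by auto
      then show False using k[OF y(1)] agree[of k] by simp
    qed
  qed
qed

section \<open>Separation from an ultrafilter\<close>

text \<open>A position of the game is a triple \<open>(t, m, A)\<close>: the union \<open>t\<close> of the answers so far, the length
  \<open>m\<close> of the initial segment that is already decided, and a large set \<open>A\<close> to which the continuation
  is confined. The predicate \<open>ext n\<close> describes the legal transitions of round \<open>n\<close>, after which
  \<open>G n\<close> can no longer be reached.\<close>

lemma gdelta_sigma_ideal_separation:
  assumes J: "ideal_on_omega J" "gdelta_sigma_in powerset_topology J"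
    and M: "prime_ideal_on_omega M" "J \<subseteq> M"
  obtains C :: "nat \<Rightarrow> nat set set" where
    "\<And>n. closedin powerset_topology (C n)"
    "\<And>n A B. A \<in> C n \<Longrightarrow> B \<subseteq> A \<Longrightarrow> B \<in> C n"
    "\<And>n. C n \<subseteq> M" "J \<subseteq> (\<Union>n. C n)"
proof -
  obtain \<U> where \<U>: "countable \<U>" "\<And>G. G \<in> \<U> \<Longrightarrow> gdelta_in powerset_topology G" "\<Union>\<U> = J"
    using J(2) unfolding gdelta_sigma_in_def union_of_def by auto
  have "\<U> \<noteq> {}" using \<U>(3) ideal_on_omega_finite[OF J(1), of "{}"] by auto
  define G where "G = from_nat_into \<U>"
  have G: "gdelta_in powerset_topology (G n)" "(\<Union>n. G n) = J" for n
    using \<U> \<open>\<U> \<noteq> {}\<close> by (auto simp: G_def from_nat_into range_from_nat_into)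

  define ext where "ext n = (\<lambda>(t, m, A) t' m' A'. A' \<notin> M \<and> A' \<subseteq> A \<and> m \<le> m' \<and> finite t' \<and>
      t' \<subseteq> {..<m'} \<and> t' \<inter> {..<m} = t \<and> t' \<subseteq> t \<union> A' \<and>
      (\<forall>y\<in>G n. y \<inter> {..<m'} = t' \<longrightarrow> \<not> y \<subseteq> t' \<union> A'))"
    for n and t' A' :: "nat set" and m' :: nat
  \<comment> \<open>The same answer may be given to many large sets. Keeping one of them per answer makes the
    tree of positions countable, and no answer is lost.\<close>
  define succs where "succs n p = (\<lambda>(t', m'). (t', m', SOME A'. ext n p t' m' A')) `
      {(t', m'). \<exists>A'. ext n p t' m' A'}" for n p
  define pos where "pos = rec_nat {({}, 0, UNIV)} (\<lambda>n P. \<Union>p\<in>P. succs n p)"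
  have pos_0: "pos 0 = {({}, 0, UNIV)}" and pos_Suc: "pos (Suc n) = (\<Union>p\<in>pos n. succs n p)" for n
    by (simp_all add: pos_def)
  have succsD: "ext n p t' m' A'" if "(t', m', A') \<in> succs n p" for n p t' m' A'
    using that by (auto simp: succs_def intro: someI)
  have "countable (succs n p)" for n p
  proof -
    have "{(t', m'). \<exists>A'. ext n p t' m' A'} \<subseteq> Collect finite \<times> UNIV"
      by (auto simp: ext_def split: prod.splits)
    moreover have "countable ((Collect finite :: nat set set) \<times> (UNIV :: nat set))"
      by (intro countable_SIGMA countable_Collect_finite) auto
    ultimately show ?thesis unfolding succs_def by (meson countable_image countable_subset)
  qed
  then have "countable (pos n)" for n
    by (induction n) (auto simp: pos_0 pos_Suc)
  have inv: "A \<notin> M \<and> t \<subseteq> {..<m}" if "(t, m, A) \<in> pos n" for n t m A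
  proof (cases n)
    case 0
    then show ?thesis
      using that M(1) by (simp add: pos_0 prime_ideal_on_omega_def ideal_on_omega_proper)
  next
    case (Suc k)
    then show ?thesis
      using that by (auto simp: pos_Suc ext_def dest!: succsD split: prod.splits)
  qed

  \<comment> \<open>the sets that contain no answer available at position \<open>p\<close> in round \<open>n\<close>\<close>
  define C where "C = (\<lambda>(n, p). {B. \<forall>q\<in>succs n p. \<not> fst q - fst p \<subseteq> B})"
  have closed: "closedin powerset_topology (C (n, p))" for n p
    unfolding closedin_powerset_topology_iff
  proof (intro allI impI)
    fix x assume *: "\<forall>k. \<exists>y\<in>C (n, p). y \<inter> {..<k} = x \<inter> {..<k}"
    have "\<not> fst q - fst p \<subseteq> x" if q: "q \<in> succs n p" for q
    proof
      assume sub: "fst q - fst p \<subseteq> x"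
      obtain t' m' A' where "q = (t', m', A')" by (cases q)
      then have "fst q \<subseteq> {..<m'}"
        using q by (auto simp: ext_def dest!: succsD split: prod.splits)
      moreover obtain y where "y \<in> C (n, p)" "y \<inter> {..<m'} = x \<inter> {..<m'}" using * by blast
      ultimately have "fst q - fst p \<subseteq> y" using sub by blast
      then show False using \<open>y \<in> C (n, p)\<close> q by (auto simp: C_def)
    qed
    then show "x \<in> C (n, p)" by (simp add: C_def)
  qed
  have sub_M: "C (n, p) \<subseteq> M" if p: "p \<in> pos n" for n p
  proof
    fix B assume B: "B \<in> C (n, p)"
    show "B \<in> M"
    proof (rule ccontr)
      assume "B \<notin> M"
      obtain t m A where p_eq: "p = (t, m, A)" by (cases p)
      have A: "A \<inter> B \<notin> M" and t: "t \<subseteq> {..<m}"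
        using p prime_ideal_on_omega_Int[OF M(1) _ \<open>B \<notin> M\<close>] inv by (auto simp: p_eq)
      \<comment> \<open>Since \<open>B\<close> is large, presenting \<open>A \<inter> B\<close> is a legal move, and the answer to it lies in \<open>B\<close>.\<close>
      have "G n \<subseteq> J" using G(2) by blast
      moreover have "A \<inter> B \<notin> J" using A M(2) by blast
      ultimately obtain t' m' where *: "m \<le> m'" "t' \<subseteq> {..<m'}" "t' \<inter> {..<m} = t" "t' \<subseteq> t \<union> (A \<inter> B)"
        "\<And>y. y \<in> G n \<Longrightarrow> y \<inter> {..<m'} = t' \<Longrightarrow> \<not> y \<subseteq> t' \<union> (A \<inter> B)"
        using gdelta_in_ideal_avoid[OF J(1) G(1) _ _ t] by metis
      have "finite t'" using *(2) finite_subset by blast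
      then have "ext n p t' m' (A \<inter> B)" using * A by (simp add: ext_def p_eq)
      then have "\<exists>q\<in>succs n p. fst q = t'" unfolding succs_def by force
      moreover have "t' - fst p \<subseteq> B" using *(4) by (auto simp: p_eq)
      ultimately show False using B by (auto simp: C_def)
    qed
  qed
  have cover: "\<exists>n. \<exists>p\<in>pos n. B \<in> C (n, p)" if B: "B \<in> J" for B
  proof (rule ccontr)
    assume "\<not> ?thesis"
    then have step: "\<exists>q\<in>succs n p. fst q - fst p \<subseteq> B" if "p \<in> pos n" for n p
      using that by (auto simp: C_def)
    \<comment> \<open>an infinite run all of whose answers lie in \<open>B\<close>\<close>
    have "\<exists>f. \<forall>n. f n \<in> pos n \<and> (f (Suc n) \<in> succs n (f n) \<and> fst (f (Suc n)) - fst (f n) \<subseteq> B)"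
    proof (rule dependent_nat_choice)
      show "\<exists>q. q \<in> pos (Suc n) \<and> q \<in> succs n p \<and> fst q - fst p \<subseteq> B" if "p \<in> pos n" for p n
        using step[OF that] that unfolding pos_Suc by blast
    qed (simp add: pos_0)
    then obtain f where f: "\<And>n. f n \<in> pos n" "\<And>n. f (Suc n) \<in> succs n (f n)"
      "\<And>n. fst (f (Suc n)) - fst (f n) \<subseteq> B" by metis
    define t m A where "t n = fst (f n)" and "m n = fst (snd (f n))" and "A n = snd (snd (f n))" for n
    have f_eq: "f n = (t n, m n, A n)" for n by (simp add: t_def m_def A_def)
    have "ext n (t n, m n, A n) (t (Suc n)) (m (Suc n)) (A (Suc n))" for n
      using succsD f(2) by (metis f_eq)
    then have step: "A (Suc n) \<subseteq> A n" "m n \<le> m (Suc n)" "t (Suc n) \<subseteq> {..<m (Suc n)}"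
        "t (Suc n) \<inter> {..<m n} = t n" "t (Suc n) \<subseteq> t n \<union> A (Suc n)"
      and avoid: "\<And>y. y \<in> G n \<Longrightarrow> y \<inter> {..<m (Suc n)} = t (Suc n) \<Longrightarrow> \<not> y \<subseteq> t (Suc n) \<union> A (Suc n)"
      for n by (simp_all add: ext_def)
    have t0: "t 0 = {}" using f(1)[of 0] by (simp add: pos_0 t_def)
    have A_anti: "A j \<subseteq> A i" if "i \<le> j" for i j
      using step(1) that by (rule lift_Suc_antimono_le)
    have m_mono: "m i \<le> m j" if "i \<le> j" for i j
      using step(2) that by (rule lift_Suc_mono_le)
    have t_cut: "t j \<inter> {..<m i} = t i" if "i \<le> j" for i j
      using that
    proof (induction j rule: dec_induct)
      case base
      then show ?case using step(3) t0 by (cases i) auto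
    next
      case (step j)
      have "{..<m i} = {..<m j} \<inter> {..<m i}" using m_mono[OF step(1)] by auto
      then show ?case using \<open>\<And>n. t (Suc n) \<inter> {..<m n} = t n\<close> step.IH by (metis Int_assoc)
    qed
    have t_sub: "t j \<subseteq> t i \<union> A i" if "i \<le> j" for i j
      using that
    proof (induction j rule: dec_induct)
      case (step j)
      then show ?case using \<open>t (Suc j) \<subseteq> t j \<union> A (Suc j)\<close> A_anti[of i "Suc j"] by auto
    qed simp
    \<comment> \<open>The outcome \<open>y\<close> of the run is a subset of \<open>B\<close>, hence in some \<open>G n\<close>; but round \<open>n\<close> has
      excluded \<open>G n\<close>, because \<open>y\<close> obeys the restrictions imposed there.\<close>
    define y where "y = (\<Union>n. t n)"
    have "t n \<subseteq> B" for n
      using f(3) by (induction n) (auto simp: t0 t_def[symmetric])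
    then have "y \<in> J"
      by (intro ideal_on_omega_subset[OF J(1) B]) (auto simp: y_def)
    then obtain n where "y \<in> G n" using G(2) by blast
    moreover have "y \<inter> {..<m (Suc n)} = t (Suc n)"
    proof -
      have "t j \<inter> {..<m (Suc n)} \<subseteq> t (Suc n)" for j
      proof (cases "Suc n \<le> j")
        case True
        then show ?thesis using t_cut by blast
      next
        case False
        then show ?thesis using t_cut[of j "Suc n"] by auto
      qed
      then show ?thesis using step(3)[of n] by (auto simp: y_def)
    qed
    moreover have "y \<subseteq> t (Suc n) \<union> A (Suc n)"
    proof -
      have "t j \<subseteq> t (Suc n) \<union> A (Suc n)" for j
        using t_sub[of "Suc n" j] t_cut[of j "Suc n"] by (cases "Suc n \<le> j") auto
      then show ?thesis by (auto simp: y_def)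
    qed
    ultimately show False using avoid by blast
  qed

  define P where "P = (SIGMA n:UNIV. pos n)"
  have "countable P" unfolding P_def using \<open>\<And>n. countable (pos n)\<close> by (intro countable_SIGMA) auto
  moreover have "P \<noteq> {}" using pos_0 by (auto simp: P_def)
  ultimately have rng: "range (from_nat_into P) = P" by (rule range_from_nat_into[rotated])
  show thesis
  proof
    fix n
    obtain k p where kp: "from_nat_into P n = (k, p)" "p \<in> pos k"
      using rng unfolding P_def by (metis SigmaE rangeI)
    show "closedin powerset_topology (C (from_nat_into P n))" using closed kp by simp
    show "C (from_nat_into P n) \<subseteq> M" using sub_M kp by simp
    show "B \<in> C (from_nat_into P n)" if "A \<in> C (from_nat_into P n)" "B \<subseteq> A" for A B
      using that unfolding kp(1) C_def prod.case mem_Collect_eq by (metis subset_trans)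
  next
    have "J \<subseteq> (\<Union>np\<in>P. C np)" using cover by (fastforce simp: P_def)
    also have "\<dots> = (\<Union>n. C (from_nat_into P n))" by (metis rng image_image)
    finally show "J \<subseteq> (\<Union>n. C (from_nat_into P n))" .
  qed
qed

section \<open>The ideal generated by closed hereditary families\<close>

text \<open>If for every \<open>m\<close> the segment below \<open>m\<close> were covered by \<open>n\<close> members of \<open>D\<close>, these covers would
  converge along the ultrafilter dual to \<open>M\<close>. Its \<open>n\<close> limits lie in \<open>D\<close>, hence in \<open>M\<close>, and they
  cover all natural numbers: each number is covered for cofinitely many \<open>m\<close>, hence by one of the
  \<open>n\<close> sets for a large set of \<open>m\<close>.\<close>

lemma compact_cover_by_closed_hereditary:
  fixes b :: "nat \<Rightarrow> nat \<Rightarrow> nat set"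
  assumes M: "prime_ideal_on_omega M"
    and D: "closedin powerset_topology D" "\<And>A B. A \<in> D \<Longrightarrow> B \<subseteq> A \<Longrightarrow> B \<in> D" "D \<subseteq> M"
    and b: "\<And>m i. i < n \<Longrightarrow> b m i \<in> D"
  shows "\<exists>m. \<not> {..<m} \<subseteq> (\<Union>i<n. b m i)"
proof (rule ccontr)
  assume "\<not> ?thesis"
  then have cov: "{..<m} \<subseteq> (\<Union>i<n. b m i)" for m by blast
  have M': "ideal_on_omega M" using M by (simp add: prime_ideal_on_omega_def)
  define L where "L i = {j. {m. j \<in> b m i} \<notin> M}" for i
  have "L i \<in> D" if "i < n" for i
  proof -
    have "L i \<inter> {..<k} \<in> D" for k
    proof -
      have "(\<Inter>j\<in>L i \<inter> {..<k}. {m. j \<in> b m i}) \<notin> M"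
        by (rule prime_ideal_on_omega_INT[OF M]) (auto simp: L_def)
      then have "(\<Inter>j\<in>L i \<inter> {..<k}. {m. j \<in> b m i}) \<noteq> {}"
        using ideal_on_omega_finite[OF M'] by auto
      then obtain m where "L i \<inter> {..<k} \<subseteq> b m i" by blast
      then show ?thesis using D(2) b[OF that] by blast
    qed
    then show ?thesis
      using D(1) unfolding closedin_powerset_topology_iff by (metis Int_assoc Int_absorb)
  qed
  then have "(\<Union>i<n. L i) \<in> M"
    using D(3) by (intro ideal_on_omega_UN[OF M']) auto
  moreover have "j \<in> (\<Union>i<n. L i)" for j
  proof (rule ccontr)
    assume "j \<notin> (\<Union>i<n. L i)"
    then have "{..j} \<union> (\<Union>i<n. {m. j \<in> b m i}) \<in> M"
      by (intro ideal_on_omega_Un[OF M'] ideal_on_omega_UN[OF M'])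
        (auto simp: L_def intro: ideal_on_omega_finite[OF M'])
    moreover have "{..j} \<union> (\<Union>i<n. {m. j \<in> b m i}) = UNIV"
    proof -
      have "m \<in> {..j} \<union> (\<Union>i<n. {m. j \<in> b m i})" for m
      proof (cases "m \<le> j")
        case False
        then have "j \<in> (\<Union>i<n. b m i)" using cov[of m] by (meson lessThan_iff not_le subsetD)
        then show ?thesis by blast
      qed auto
      then show ?thesis by blast
    qed
    ultimately show False using ideal_on_omega_proper[OF M'] by simp
  qed
  ultimately show False using ideal_on_omega_proper[OF M'] by (metis UNIV_eq_I)
qed

text \<open>Closedness of the levels \<open>K n\<close> of the generated ideal is immediate if membership only speaks of
  finite initial segments of \<open>B\<close> being covered. Compactness, in the form of the preceding
  lemma, is then needed only to see that the ideal is proper. Each level uses \<open>n\<close> both for the number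
  of sets and for the number of families, so that the union of a member of \<open>K n\<close> and one
  of \<open>K k\<close> is in \<open>K (n + k)\<close>.\<close>

lemma fsigma_ideal_from_closed_hereditary:
  fixes C :: "nat \<Rightarrow> nat set set"
  assumes M: "prime_ideal_on_omega M"
    and closed: "\<And>n. closedin powerset_topology (C n)"
    and hered: "\<And>n A B. A \<in> C n \<Longrightarrow> B \<subseteq> A \<Longrightarrow> B \<in> C n"
    and sub: "\<And>n. C n \<subseteq> M" and fin: "\<And>A. finite A \<Longrightarrow> A \<in> (\<Union>n. C n)"
  shows "\<exists>L. ideal_on_omega L \<and> fsigma_in powerset_topology L \<and> (\<Union>n. C n) \<subseteq> L"
proof -
  define D where "D n = (\<Union>i<n. C i)" for n
  have D_closed: "closedin powerset_topology (D n)" for n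
    unfolding D_def using closed by (intro closedin_Union) auto
  have D_hered: "B \<in> D n" if "A \<in> D n" "B \<subseteq> A" for A B n
    using that hered unfolding D_def by blast
  have D_sub: "D n \<subseteq> M" for n using sub by (auto simp: D_def)
  have D_mono: "D i \<subseteq> D j" if "i \<le> j" for i j
    using that by (fastforce simp: D_def)
  define K where
    "K n = {B. \<forall>m. \<exists>b. (\<forall>i<n. b i \<in> D n) \<and> B \<inter> {..<m} \<subseteq> (\<Union>i<n. b i)}" for n
  define L where "L = (\<Union>n. K n)"
  have C_L: "(\<Union>n. C n) \<subseteq> L"
  proof
    fix B assume "B \<in> (\<Union>n. C n)"
    then obtain n where "B \<in> D (Suc n)" by (auto simp: D_def)
    then have "B \<in> K (Suc n)" unfolding K_def by (auto intro!: exI[of _ "\<lambda>_. B"])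
    then show "B \<in> L" by (auto simp: L_def)
  qed
  have "closedin powerset_topology (K n)" for n
    unfolding closedin_powerset_topology_iff
  proof (intro allI impI)
    fix x assume *: "\<forall>k. \<exists>y\<in>K n. y \<inter> {..<k} = x \<inter> {..<k}"
    show "x \<in> K n"
      unfolding K_def
    proof (intro CollectI allI)
      fix m
      obtain y where y: "y \<in> K n" "y \<inter> {..<m} = x \<inter> {..<m}" using * by blast
      then have "\<exists>b. (\<forall>i<n. b i \<in> D n) \<and> y \<inter> {..<m} \<subseteq> (\<Union>i<n. b i)"
        unfolding K_def by blast
      then show "\<exists>b. (\<forall>i<n. b i \<in> D n) \<and> x \<inter> {..<m} \<subseteq> (\<Union>i<n. b i)"
        unfolding y(2) .
    qed
  qed
  then have "fsigma_in powerset_topology L"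
    unfolding L_def by (intro fsigma_in_Union) (auto intro: closed_imp_fsigma_in)
  moreover have "ideal_on_omega L"
    unfolding ideal_on_omega_def
  proof (intro conjI allI impI ballI)
    show "A \<in> L" if "finite A" for A using fin[OF that] C_L by blast
  next
    fix A B assume "A \<in> L" "B \<subseteq> A"
    then obtain n where "A \<in> K n" by (auto simp: L_def)
    have "B \<in> K n"
      unfolding K_def
    proof (intro CollectI allI)
      fix m
      obtain b where "\<forall>i<n. b i \<in> D n" "A \<inter> {..<m} \<subseteq> (\<Union>i<n. b i)"
        using \<open>A \<in> K n\<close> unfolding K_def by blast
      then show "\<exists>b. (\<forall>i<n. b i \<in> D n) \<and> B \<inter> {..<m} \<subseteq> (\<Union>i<n. b i)"
        using \<open>B \<subseteq> A\<close> by (intro exI[of _ b]) blast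
    qed
    then show "B \<in> L" by (auto simp: L_def)
  next
    fix A B assume "A \<in> L" "B \<in> L"
    then obtain n k where A: "A \<in> K n" and B: "B \<in> K k" by (auto simp: L_def)
    have "A \<union> B \<in> K (n + k)"
      unfolding K_def
    proof (intro CollectI allI)
      fix m
      obtain a where a: "\<forall>i<n. a i \<in> D n" "A \<inter> {..<m} \<subseteq> (\<Union>i<n. a i)"
        using A unfolding K_def by blast
      obtain b where b: "\<forall>i<k. b i \<in> D k" "B \<inter> {..<m} \<subseteq> (\<Union>i<k. b i)"
        using B unfolding K_def by blast
      define c where "c i = (if i < n then a i else b (i - n))" for i
      have "\<forall>i<n + k. c i \<in> D (n + k)"
        unfolding c_def using a(1) b(1) D_mono[of n "n + k"] D_mono[of k "n + k"] by auto
      moreover have "(\<Union>i<n. a i) \<subseteq> (\<Union>i<n + k. c i)" by (fastforce simp: c_def)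
      moreover have "(\<Union>i<k. b i) \<subseteq> (\<Union>i<n + k. c i)"
      proof
        fix x assume "x \<in> (\<Union>i<k. b i)"
        then obtain i where "i < k" "x \<in> b i" by blast
        then show "x \<in> (\<Union>i<n + k. c i)" by (intro UN_I[of "n + i"]) (auto simp: c_def)
      qed
      moreover from calculation(2,3) have "(A \<union> B) \<inter> {..<m} \<subseteq> (\<Union>i<n + k. c i)"
        using a(2) b(2) unfolding Int_Un_distrib2 by (meson Un_least subset_trans)
      ultimately show "\<exists>c. (\<forall>i<n + k. c i \<in> D (n + k)) \<and> (A \<union> B) \<inter> {..<m} \<subseteq> (\<Union>i<n + k. c i)"
        by (intro exI[of _ c] conjI)
    qed
    then show "A \<union> B \<in> L" by (auto simp: L_def)
  next
    show "UNIV \<notin> L"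
    proof
      assume "UNIV \<in> L"
      then obtain n where "UNIV \<in> K n" by (auto simp: L_def)
      then have "\<forall>m. \<exists>b. (\<forall>i<n. b i \<in> D n) \<and> {..<m} \<subseteq> (\<Union>i<n. b i)"
        unfolding K_def by simp
      from choice[OF this]
      obtain b where b: "\<forall>m. (\<forall>i<n. b m i \<in> D n) \<and> {..<m} \<subseteq> (\<Union>i<n. b m i)" ..
      have "\<exists>m. \<not> {..<m} \<subseteq> (\<Union>i<n. b m i)"
        by (rule compact_cover_by_closed_hereditary[OF M D_closed D_hered D_sub]) (use b in auto)
      then show False using b by simp
    qed
  qed
  ultimately show ?thesis using C_L by blast
qed

theorem proposition10p1:
  fixes J :: "nat set set"
  assumes "ideal_on_omega J"
    and "gdelta_sigma_in powerset_topology J"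
  shows "\<exists>J'. ideal_on_omega J' \<and> fsigma_in powerset_topology J' \<and> J \<subseteq> J'"
proof -
  obtain M where M: "prime_ideal_on_omega M" "J \<subseteq> M"
    using ideal_on_omega_extend_prime[OF assms(1)] .
  obtain C :: "nat \<Rightarrow> nat set set" where C: "\<And>n. closedin powerset_topology (C n)"
    "\<And>n A B. A \<in> C n \<Longrightarrow> B \<subseteq> A \<Longrightarrow> B \<in> C n" "\<And>n. C n \<subseteq> M" "J \<subseteq> (\<Union>n. C n)"
    using gdelta_sigma_ideal_separation[OF assms M] by metis
  have "A \<in> (\<Union>n. C n)" if "finite A" for A
    using ideal_on_omega_finite[OF assms(1) that] C(4) by blast
  then have "\<exists>L. ideal_on_omega L \<and> fsigma_in powerset_topology L \<and> (\<Union>n. C n) \<subseteq> L"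
    by (intro fsigma_ideal_from_closed_hereditary[OF M(1) C(1-3)])
  then show ?thesis using C(4) by blast
qed

end
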